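(* Let $(K,\tau)$ be an infinite compact metrisable topological space. Let $\mathsf d_{\rm discr}$ denote the discrete distance on $K$, i.e. $\mathsf d_{\rm discr}(x,y)=1$ if $x\neq y$ and $\mathsf d_{\rm discr}(x,x)=0$. Then the Banach space $\mathrm{Lip}_b(K,\tau,\mathsf d_{\rm discr})$ is not isomorphic to a dual Banach space, i.e. there is no real Banach space $\mathbb B$ whose dual $\mathbb B'$ is isomorphic to $\mathrm{Lip}_b(K,\tau,\mathsf d_{\rm discr})$.
   Context: For a set $X$ with a topology $\tau$ and an (extended) distance $\mathsf d$, $\mathrm{Lip}_b(X,\tau,\mathsf d)$ denotes the vector space of all bounded functions $f\colon X\to\mathbb R$ that are $\tau$-continuous and $\mathsf d$-Lipschitz (i.e. $|f(x)-f(y)|\leq L\,\mathsf d(x,y)$ for some $L\geq 0$ and all $x,y\in X$), endowed with the norm $\|f\|_{\mathrm{Lip}_b(X,\tau,\mathsf d)}=\mathrm{Lip}(f,\mathsf d)+\sup_{x\in X}|f(x)|$, where $\mathrm{Lip}(f,\mathsf d)=\sup\{|f(x)-f(y)|/\mathsf d(x,y):x\neq y\}$. It is a Banach space. Two Banach spaces are isomorphic if there is a linear homeomorphism between them (not necessarily isometric). *)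

theory Defs
  imports "HOL-Analysis.Analysis"
begin

text \<open>
  The underlying set of \<open>(X, \<tau>)\<close> is the carrier of an abstract topology, and extended distances
  take values in \<^typ>\<open>ennreal\<close>. A real function on \<open>topspace X\<close> is represented by the HOL function
  that agrees with it on \<open>topspace X\<close> and is \<^const>\<open>undefined\<close> elsewhere
  (\<^const>\<open>extensional\<close>), so that distinct elements of \<open>Lip_b\<close> are distinct functions on the carrier.
\<close>

definition discrete_dist :: "'a \<Rightarrow> 'a \<Rightarrow> ennreal" where
  "discrete_dist x y = (if x = y then 0 else 1)"

definition Lip_b :: "'a topology \<Rightarrow> ('a \<Rightarrow> 'a \<Rightarrow> ennreal) \<Rightarrow> ('a \<Rightarrow> real) set" where
  "Lip_b X d = {f \<in> extensional (topspace X).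
      bounded (f ` topspace X) \<and>
      continuous_map X euclideanreal f \<and>
      (\<exists>L\<ge>0. \<forall>x\<in>topspace X. \<forall>y\<in>topspace X. ennreal \<bar>f x - f y\<bar> \<le> ennreal L * d x y)}"

text \<open>In \<^typ>\<open>ennreal\<close> division by infinity gives \<open>0\<close>, so pairs at infinite distance do not
  contribute to the Lipschitz constant.\<close>

definition Lip_const :: "'a topology \<Rightarrow> ('a \<Rightarrow> 'a \<Rightarrow> ennreal) \<Rightarrow> ('a \<Rightarrow> real) \<Rightarrow> ennreal" where
  "Lip_const X d f =
     (SUP (x, y) \<in> {(x, y). x \<in> topspace X \<and> y \<in> topspace X \<and> x \<noteq> y}. ennreal \<bar>f x - f y\<bar> / d x y)"

definition Lip_b_norm :: "'a topology \<Rightarrow> ('a \<Rightarrow> 'a \<Rightarrow> ennreal) \<Rightarrow> ('a \<Rightarrow> real) \<Rightarrow> real" where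
  "Lip_b_norm X d f = enn2real (Lip_const X d f + (SUP x \<in> topspace X. ennreal \<bar>f x\<bar>))"

definition Lip_b_dist ::
    "'a topology \<Rightarrow> ('a \<Rightarrow> 'a \<Rightarrow> ennreal) \<Rightarrow> ('a \<Rightarrow> real) \<Rightarrow> ('a \<Rightarrow> real) \<Rightarrow> real" where
  "Lip_b_dist X d f g = Lip_b_norm X d (\<lambda>x\<in>topspace X. f x - g x)"

definition Lip_b_topology ::
    "'a topology \<Rightarrow> ('a \<Rightarrow> 'a \<Rightarrow> ennreal) \<Rightarrow> ('a \<Rightarrow> real) topology" where
  "Lip_b_topology X d = Metric_space.mtopology (Lip_b X d) (Lip_b_dist X d)"

definition linear_homeomorphism_Lip_b ::
    "'a topology \<Rightarrow> ('a \<Rightarrow> 'a \<Rightarrow> ennreal) \<Rightarrow> ('v::real_normed_vector \<Rightarrow> 'a \<Rightarrow> real) \<Rightarrow> bool" where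
  "linear_homeomorphism_Lip_b X d T \<longleftrightarrow>
     (\<forall>u v. T (u + v) = (\<lambda>x\<in>topspace X. T u x + T v x)) \<and>
     (\<forall>c u. T (c *\<^sub>R u) = (\<lambda>x\<in>topspace X. c * T u x)) \<and>
     homeomorphic_map euclidean (Lip_b_topology X d) T"

lemma Lip_b_add:
  assumes "f \<in> Lip_b X d" "g \<in> Lip_b X d"
  shows "(\<lambda>x\<in>topspace X. f x + g x) \<in> Lip_b X d"
proof -
  obtain L where L: "L \<ge> 0"
    "\<And>x y. x \<in> topspace X \<Longrightarrow> y \<in> topspace X \<Longrightarrow> ennreal \<bar>f x - f y\<bar> \<le> ennreal L * d x y"
    using assms(1) unfolding Lip_b_def by blast
  obtain M where M: "M \<ge> 0"
    "\<And>x y. x \<in> topspace X \<Longrightarrow> y \<in> topspace X \<Longrightarrow> ennreal \<bar>g x - g y\<bar> \<le> ennreal M * d x y"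
    using assms(2) unfolding Lip_b_def by blast
  have "ennreal \<bar>(f x + g x) - (f y + g y)\<bar> \<le> ennreal (L + M) * d x y"
    if "x \<in> topspace X" "y \<in> topspace X" for x y
  proof -
    have "ennreal \<bar>(f x + g x) - (f y + g y)\<bar> \<le> ennreal (\<bar>f x - f y\<bar> + \<bar>g x - g y\<bar>)"
      by (intro ennreal_leI) linarith
    also have "\<dots> = ennreal \<bar>f x - f y\<bar> + ennreal \<bar>g x - g y\<bar>"
      by simp
    also have "\<dots> \<le> ennreal L * d x y + ennreal M * d x y"
      using that L M by (intro add_mono) auto
    finally show ?thesis
      using L M by (simp add: distrib_right)
  qed
  then have lip: "\<exists>L\<ge>0. \<forall>x\<in>topspace X. \<forall>y\<in>topspace X.
      ennreal \<bar>(f x + g x) - (f y + g y)\<bar> \<le> ennreal L * d x y"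
    using L(1) M(1) by (intro exI[of _ "L + M"]) auto
  have "bounded ((\<lambda>x. f x + g x) ` topspace X)"
    using assms by (intro bounded_plus_comp) (auto simp: Lip_b_def)
  moreover have "continuous_map X euclideanreal (\<lambda>x. f x + g x)"
    using assms by (intro continuous_map_add) (auto simp: Lip_b_def)
  then have "continuous_map X euclideanreal (\<lambda>x\<in>topspace X. f x + g x)"
    by (rule continuous_map_eq) simp
  ultimately show ?thesis
    using lip by (auto simp: Lip_b_def cong: image_cong)
qed

lemma Lip_b_scale:
  assumes "f \<in> Lip_b X d"
  shows "(\<lambda>x\<in>topspace X. c * f x) \<in> Lip_b X d"
proof -
  obtain L where L: "L \<ge> 0"
    "\<And>x y. x \<in> topspace X \<Longrightarrow> y \<in> topspace X \<Longrightarrow> ennreal \<bar>f x - f y\<bar> \<le> ennreal L * d x y"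
    using assms(1) unfolding Lip_b_def by blast
  have "ennreal \<bar>c * f x - c * f y\<bar> \<le> ennreal (\<bar>c\<bar> * L) * d x y"
    if "x \<in> topspace X" "y \<in> topspace X" for x y
  proof -
    have "ennreal \<bar>c * f x - c * f y\<bar> = ennreal \<bar>c\<bar> * ennreal \<bar>f x - f y\<bar>"
      by (simp add: abs_mult ennreal_mult flip: right_diff_distrib)
    also have "\<dots> \<le> ennreal \<bar>c\<bar> * (ennreal L * d x y)"
      using that L by (intro mult_left_mono) auto
    finally show ?thesis
      using L(1) by (simp add: ennreal_mult mult.assoc)
  qed
  then have lip: "\<exists>L\<ge>0. \<forall>x\<in>topspace X. \<forall>y\<in>topspace X.
      ennreal \<bar>c * f x - c * f y\<bar> \<le> ennreal L * d x y"
    using L(1) by (intro exI[of _ "\<bar>c\<bar> * L"]) auto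
  have "bounded ((\<lambda>x. c *\<^sub>R f x) ` topspace X)"
    using assms by (intro bounded_scaleR_comp) (auto simp: Lip_b_def)
  moreover have "continuous_map X euclideanreal (\<lambda>x. c * f x)"
    using assms by (intro continuous_map_real_mult_left) (auto simp: Lip_b_def)
  then have "continuous_map X euclideanreal (\<lambda>x\<in>topspace X. c * f x)"
    by (rule continuous_map_eq) simp
  ultimately show ?thesis
    using lip by (auto simp: Lip_b_def cong: image_cong)
qed

lemma Lip_b_diff:
  assumes "f \<in> Lip_b X d" "g \<in> Lip_b X d"
  shows "(\<lambda>x\<in>topspace X. f x - g x) \<in> Lip_b X d"
  using Lip_b_add[OF assms(1) Lip_b_scale[OF assms(2), of "-1"]]
  by (simp cong: restrict_cong)

lemma Lip_b_norm_finite: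
  assumes "f \<in> Lip_b X d"
  shows "Lip_const X d f + (SUP x \<in> topspace X. ennreal \<bar>f x\<bar>) < top"
proof -
  obtain L where L: "L \<ge> 0"
    "\<And>x y. x \<in> topspace X \<Longrightarrow> y \<in> topspace X \<Longrightarrow> ennreal \<bar>f x - f y\<bar> \<le> ennreal L * d x y"
    using assms(1) unfolding Lip_b_def by blast
  have "Lip_const X d f \<le> ennreal L"
    unfolding Lip_const_def
  proof (safe intro!: SUP_least)
    fix x y assume "x \<in> topspace X" "y \<in> topspace X"
    then have *: "ennreal \<bar>f x - f y\<bar> / d x y \<le> ennreal L * d x y / d x y"
      by (intro divide_right_mono_ennreal L)
    also have "\<dots> \<le> ennreal L"
      by (cases "d x y = 0 \<or> d x y = top")
        (auto simp: ennreal_divide_top ennreal_mult_divide_eq ennreal_mult_top 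
                    ennreal_times_divide[symmetric] ennreal_divide_self less_top)
    finally show "ennreal \<bar>f x - f y\<bar> / d x y \<le> ennreal L" .
  qed
  moreover obtain B where "\<And>x. x \<in> topspace X \<Longrightarrow> \<bar>f x\<bar> \<le> B"
    using assms by (auto simp: Lip_b_def bounded_iff)
  then have "(SUP x \<in> topspace X. ennreal \<bar>f x\<bar>) \<le> ennreal B"
    by (intro SUP_least ennreal_leI) auto
  ultimately show ?thesis
    by (meson add_mono ennreal_less_top le_less_trans ennreal_add_less_top)
qed

lemma Metric_space_Lip_b: "Metric_space (Lip_b X d) (Lip_b_dist X d)"
proof
  fix f g h
  show "0 \<le> Lip_b_dist X d f g"
    by (simp add: Lip_b_dist_def Lip_b_norm_def)
  show "Lip_b_dist X d f g = Lip_b_dist X d g f"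
    unfolding Lip_b_dist_def Lip_b_norm_def Lip_const_def
    by (intro arg_cong[where f = enn2real] arg_cong2[where f = "(+)"] SUP_cong refl)
       (auto intro!: arg_cong2[where f = "(/)"] arg_cong[where f = ennreal])
  assume fg: "f \<in> Lip_b X d" "g \<in> Lip_b X d"
  let ?N = "\<lambda>f. Lip_const X d f + (SUP x \<in> topspace X. ennreal \<bar>f x\<bar>)"
  let ?D = "\<lambda>f g. \<lambda>x\<in>topspace X. f x - g x :: real"
  show "Lip_b_dist X d f g = 0 \<longleftrightarrow> f = g"
  proof
    assume "Lip_b_dist X d f g = 0"
    then have "?N (?D f g) = 0"
      using Lip_b_norm_finite[OF Lip_b_diff[OF fg]]
      unfolding Lip_b_dist_def Lip_b_norm_def enn2real_eq_0_iff by (metis less_irrefl)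
    then have "(SUP x \<in> topspace X. ennreal \<bar>?D f g x\<bar>) = 0"
      by (metis add_eq_0_iff_both_eq_0)
    then have "ennreal \<bar>?D f g x\<bar> \<le> 0" if "x \<in> topspace X" for x
      using that by (metis (no_types, lifting) SUP_upper)
    then have "f x = g x" if "x \<in> topspace X" for x
      using that by (force simp: ennreal_eq_0_iff)
    then show "f = g"
      using fg by (auto simp: Lip_b_def intro: extensionalityI)
  next
    assume "f = g"
    have "Lip_const X d (?D f f) \<le> 0"
      unfolding Lip_const_def by (safe intro!: SUP_least) simp
    moreover have "(SUP x \<in> topspace X. ennreal \<bar>?D f f x\<bar>) \<le> 0"
      by (rule SUP_least) simp
    ultimately have "?N (?D f f) = 0"
      by (simp only: le_zero_eq add_0_left)
    then show "Lip_b_dist X d f g = 0"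
      unfolding Lip_b_dist_def Lip_b_norm_def \<open>f = g\<close> by (simp only: enn2real_0)
  qed
  assume h: "h \<in> Lip_b X d"
  have "Lip_const X d (?D f h) \<le> Lip_const X d (?D f g) + Lip_const X d (?D g h)"
    unfolding Lip_const_def
  proof (safe intro!: SUP_least)
    fix x y assume xy: "x \<in> topspace X" "y \<in> topspace X" "x \<noteq> y"
    have "ennreal \<bar>?D f h x - ?D f h y\<bar>
        \<le> ennreal (\<bar>?D f g x - ?D f g y\<bar> + \<bar>?D g h x - ?D g h y\<bar>)"
      using xy by (intro ennreal_leI) auto
    also have "\<dots> = ennreal \<bar>?D f g x - ?D f g y\<bar> + ennreal \<bar>?D g h x - ?D g h y\<bar>"
      by simp
    finally have "ennreal \<bar>?D f h x - ?D f h y\<bar> / d x y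
        \<le> ennreal \<bar>?D f g x - ?D f g y\<bar> / d x y + ennreal \<bar>?D g h x - ?D g h y\<bar> / d x y"
      unfolding add_divide_distrib_ennreal[symmetric] by (rule divide_right_mono_ennreal)
    also have "\<dots> \<le> (SUP (x, y) \<in> {(x, y). x \<in> topspace X \<and> y \<in> topspace X \<and> x \<noteq> y}.
          ennreal \<bar>?D f g x - ?D f g y\<bar> / d x y)
        + (SUP (x, y) \<in> {(x, y). x \<in> topspace X \<and> y \<in> topspace X \<and> x \<noteq> y}.
          ennreal \<bar>?D g h x - ?D g h y\<bar> / d x y)"
      using xy by (intro add_mono; intro SUP_upper2[of "(x, y)"]) auto
    finally show "ennreal \<bar>?D f h x - ?D f h y\<bar> / d x y \<le> \<dots>" .
  qed
  moreover have "(SUP x \<in> topspace X. ennreal \<bar>?D f h x\<bar>)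
      \<le> (SUP x \<in> topspace X. ennreal \<bar>?D f g x\<bar>) + (SUP x \<in> topspace X. ennreal \<bar>?D g h x\<bar>)"
  proof (rule SUP_least)
    fix x assume x: "x \<in> topspace X"
    have "ennreal \<bar>?D f h x\<bar> \<le> ennreal (\<bar>?D f g x\<bar> + \<bar>?D g h x\<bar>)"
      using x by (intro ennreal_leI) auto
    also have "\<dots> = ennreal \<bar>?D f g x\<bar> + ennreal \<bar>?D g h x\<bar>"
      by simp
    also have "\<dots> \<le> (SUP x \<in> topspace X. ennreal \<bar>?D f g x\<bar>) + (SUP x \<in> topspace X. ennreal \<bar>?D g h x\<bar>)"
      using x by (intro add_mono SUP_upper)
    finally show "ennreal \<bar>?D f h x\<bar> \<le> \<dots>" .
  qed
  ultimately have "?N (?D f h) \<le> ?N (?D f g) + ?N (?D g h)"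
    by (rule order_trans[OF add_mono]) (simp only: ac_simps order_refl)
  moreover have "?N (?D f g) < top" "?N (?D g h) < top"
    using Lip_b_norm_finite[OF Lip_b_diff] fg h by blast+
  ultimately have "enn2real (?N (?D f h)) \<le> enn2real (?N (?D f g) + ?N (?D g h))"
    "enn2real (?N (?D f g) + ?N (?D g h)) = enn2real (?N (?D f g)) + enn2real (?N (?D g h))"
    by (intro enn2real_mono enn2real_plus; simp)+
  then show "Lip_b_dist X d f h \<le> Lip_b_dist X d f g + Lip_b_dist X d g h"
    unfolding Lip_b_dist_def Lip_b_norm_def by simp
qed

end

theory Submission
  imports Defs
begin

text \<open>
  For the discrete distance the norm of \<open>Lip_b\<close> is equivalent to the supremum norm, so the space is
  \<open>C(K)\<close>. Choose \<open>y\<^sub>n \<rightarrow> x\<close> in \<open>K\<close> and bumps \<open>f\<^sub>n\<close> with pairwise disjoint supports such that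
  \<open>f\<^sub>n(y\<^sub>n) = 1\<close> and \<open>f\<^sub>n(x) = 0\<close>. An isomorphism \<open>T\<close> from a dual space onto \<open>C(K)\<close> turns every bounded
  sequence \<open>a\<close> into the weak* convergent series \<open>S a = \<Sum> a\<^sub>n T\<^sup>-\<^sup>1 f\<^sub>n\<close>, and
  \<open>a \<mapsto> (T(S a)(y\<^sub>n) - T(S a)(x))\<^sub>n\<close> is then a bounded projection of \<open>\<ell>\<^sup>\<infinity>\<close> onto \<open>c\<^sub>0\<close>, which does not exist
  by Phillips' theorem.
\<close>

section \<open>Almost disjoint sets and Phillips' theorem\<close>

text \<open>A branch of the binary tree, with nodes coded as naturals: each set \<open>X\<close>
  yields the codes of the finite prefixes of its characteristic sequence. This gives an almost
  disjoint family with uncountably many members, all subsets of the countable set of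
  naturals.\<close>

definition prefix_codes :: "nat set \<Rightarrow> nat set" where
  "prefix_codes X = range (\<lambda>k. to_nat (map (\<lambda>i. i \<in> X) [0..<k]))"

lemma infinite_prefix_codes: "infinite (prefix_codes X)"
proof -
  have "inj (\<lambda>k. to_nat (map (\<lambda>i. i \<in> X) [0..<k]))"
    by (rule injI) (auto dest!: arg_cong[where f = length])
  then show ?thesis
    unfolding prefix_codes_def by (simp add: range_inj_infinite)
qed

text \<open>If the two sets disagree at \<open>j\<close>, their prefixes longer than
  \<open>j\<close> differ, so a common code comes from a prefix of length at most
  \<open>j\<close>.\<close>

lemma finite_prefix_codes_Int:
  assumes "X \<noteq> Y"
  shows "finite (prefix_codes X \<inter> prefix_codes Y)"
proof -
  obtain j where j: "(j \<in> X) \<noteq> (j \<in> Y)"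
    using assms by blast
  have "prefix_codes X \<inter> prefix_codes Y \<subseteq> (\<lambda>k. to_nat (map (\<lambda>i. i \<in> X) [0..<k])) ` {..j}"
  proof (clarsimp simp: prefix_codes_def)
    fix k l assume eq: "map (\<lambda>i. i \<in> X) [0..<k] = map (\<lambda>i. i \<in> Y) [0..<l]"
    then have "k = l"
      by (auto dest: arg_cong[where f = length])
    then have "k \<le> j"
      using j eq by (metis (no_types, lifting) atLeastLessThan_iff map_eq_conv not_le_imp_less set_upt zero_le)
    with \<open>k = l\<close> eq show "to_nat (map (\<lambda>i. i \<in> Y) [0..<l]) \<in> (\<lambda>k. to_nat (map (\<lambda>i. i \<in> X) [0..<k])) ` {..j}"
      by (metis atMost_iff image_eqI)
  qed
  then show ?thesis
    by (rule finite_subset) simp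
qed

lemma bounded_range_indicator: "bounded (range (indicator A :: nat \<Rightarrow> real))"
  by (rule boundedI[of _ 1]) (auto simp: indicator_def)

text \<open>Linearity is assumed on bounded sequences only, so boundedness of the partial
  combination travels with the identity through the induction.\<close>

lemma bounded_functional_sum:
  fixes \<mu> :: "(nat \<Rightarrow> real) \<Rightarrow> real"
  assumes add: "\<And>a b. bounded (range a) \<Longrightarrow> bounded (range b) \<Longrightarrow> \<mu> (\<lambda>k. a k + b k) = \<mu> a + \<mu> b"
    and scale: "\<And>c a. bounded (range a) \<Longrightarrow> \<mu> (\<lambda>k. c * a k) = c * \<mu> a"
    and "finite J" "\<And>X. X \<in> J \<Longrightarrow> bounded (range (a X))"
  shows "bounded (range (\<lambda>k. \<Sum>X\<in>J. s X * a X k)) \<and>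
    \<mu> (\<lambda>k. \<Sum>X\<in>J. s X * a X k) = (\<Sum>X\<in>J. s X * \<mu> (a X))"
  using assms(3,4)
proof (induction J rule: finite_induct)
  case empty
  have "bounded (range (\<lambda>k::nat. 0::real))"
    by simp
  from scale[OF this, of 0] show ?case
    by simp
next
  case (insert X J)
  have "bounded (range (\<lambda>k. s X *\<^sub>R a X k))"
    using insert.prems by (intro bounded_scaleR_comp) auto
  then show ?case
    using insert by (auto simp: add scale intro!: bounded_plus_comp)
qed

text \<open>Whitley's argument: modulo finite sets the members of an almost disjoint family are disjoint,
  so a bounded functional vanishing on finitely supported sequences can be larger than a given
  \<open>\<epsilon>\<close> on only finitely many of them.\<close>

lemma finite_large_on_almost_disjoint:
  fixes \<mu> :: "(nat \<Rightarrow> real) \<Rightarrow> real" and A :: "'i \<Rightarrow> nat set"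
  assumes add: "\<And>a b. bounded (range a) \<Longrightarrow> bounded (range b) \<Longrightarrow> \<mu> (\<lambda>k. a k + b k) = \<mu> a + \<mu> b"
    and scale: "\<And>c a. bounded (range a) \<Longrightarrow> \<mu> (\<lambda>k. c * a k) = c * \<mu> a"
    and bound: "\<And>a. (\<And>k. \<bar>a k\<bar> \<le> 1) \<Longrightarrow> \<bar>\<mu> a\<bar> \<le> C"
    and fin: "\<And>a. finite {k. a k \<noteq> 0} \<Longrightarrow> \<mu> a = 0"
    and disj: "\<And>X Y. X \<noteq> Y \<Longrightarrow> finite (A X \<inter> A Y)"
    and "\<epsilon> > 0"
  shows "finite {X. \<epsilon> < \<bar>\<mu> (indicator (A X))\<bar>}"
proof (rule ccontr)
  assume inf: "infinite {X. \<epsilon> < \<bar>\<mu> (indicator (A X))\<bar>}"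
  obtain N :: nat where N: "C < real N * \<epsilon>"
    using \<open>\<epsilon> > 0\<close> by (metis reals_Archimedean3)
  obtain J where J: "finite J" "card J = N" "J \<subseteq> {X. \<epsilon> < \<bar>\<mu> (indicator (A X))\<bar>}"
    using infinite_arbitrarily_large[OF inf] by blast
  \<comment> \<open>The signs turn \<open>\<mu> z\<close> into the sum of \<open>N\<close> absolute
    values, each larger than \<open>\<epsilon>\<close>; the choice of \<open>N\<close> makes this
    sum exceed \<open>C\<close>.\<close>
  define s where "s X = sgn (\<mu> (indicator (A X)))" for X
  define z where "z k = (\<Sum>X\<in>J. s X * indicator (A X) k)" for k
  define F where "F = (\<Union>X\<in>J. \<Union>Y\<in>J - {X}. A X \<inter> A Y)"
  \<comment> \<open>The correction \<open>e\<close> cancels \<open>z\<close> on the finite overlap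
    set \<open>F\<close>. Elsewhere at most one summand of \<open>z\<close> survives, so
    \<open>z + e\<close> is bounded by 1, while \<open>\<mu>\<close> does not see
    \<open>e\<close>.\<close>
  define e where "e k = (if k \<in> F then - z k else 0)" for k
  have "finite F"
    unfolding F_def using J(1) by (intro finite_UN_I finite_Diff disj) auto
  then have e: "finite {k. e k \<noteq> 0}"
    by (rule finite_subset[rotated]) (auto simp: e_def)
  then have "finite (range e)"
    by (intro finite_subset[of "range e" "insert 0 (e ` {k. e k \<noteq> 0})"]) auto
  then have be: "bounded (range e)"
    by (rule finite_imp_bounded)
  have z: "bounded (range z)" "\<mu> z = (\<Sum>X\<in>J. s X * \<mu> (indicator (A X)))"
    using bounded_functional_sum[of \<mu> J "\<lambda>X. indicator (A X)" s, OF add scale J(1) bounded_range_indicator]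
    unfolding z_def[abs_def] by blast+
  have "\<bar>z k + e k\<bar> \<le> 1" for k
  proof (cases "k \<notin> F \<and> (\<exists>X\<in>J. k \<in> A X)")
    case True
    then obtain X where X: "X \<in> J" "k \<in> A X" "k \<notin> F"
      by blast
    then have "z k = (\<Sum>Y\<in>{X}. s Y * indicator (A Y) k)"
      unfolding z_def using J(1)
      by (intro sum.mono_neutral_right) (auto simp: F_def indicator_def)
    then show ?thesis
      using X by (simp add: e_def s_def sgn_if)
  qed (auto simp: e_def z_def)
  then have "\<bar>\<mu> (\<lambda>k. z k + e k)\<bar> \<le> C"
    by (rule bound)
  then have "\<bar>\<mu> z\<bar> \<le> C"
    using add[OF z(1) be] fin[OF e] by simp
  moreover have "real N * \<epsilon> \<le> (\<Sum>X\<in>J. \<bar>\<mu> (indicator (A X))\<bar>)"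
    using sum_bounded_below[of J \<epsilon> "\<lambda>X. \<bar>\<mu> (indicator (A X))\<bar>"] J by (force simp: less_imp_le)
  moreover have "s X * \<mu> (indicator (A X)) = \<bar>\<mu> (indicator (A X))\<bar>" for X
    by (simp add: s_def sgn_if)
  ultimately show False
    using N z(2) by simp
qed

text \<open>Phillips: \<open>c\<^sub>0\<close> is not complemented in the bounded sequences; \<open>\<Lambda> n\<close> is the \<open>n\<close>-th coordinate
  of a hypothetical projection.\<close>

lemma no_projection_onto_c0:
  fixes \<Lambda> :: "nat \<Rightarrow> (nat \<Rightarrow> real) \<Rightarrow> real"
  assumes add: "\<And>n a b. bounded (range a) \<Longrightarrow> bounded (range b) \<Longrightarrow> \<Lambda> n (\<lambda>k. a k + b k) = \<Lambda> n a + \<Lambda> n b"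
    and scale: "\<And>n c a. bounded (range a) \<Longrightarrow> \<Lambda> n (\<lambda>k. c * a k) = c * \<Lambda> n a"
    and bound: "\<And>n a. (\<And>k. \<bar>a k\<bar> \<le> 1) \<Longrightarrow> \<bar>\<Lambda> n a\<bar> \<le> C"
    and id: "\<And>n a. finite {k. a k \<noteq> 0} \<Longrightarrow> \<Lambda> n a = a n"
    and tendsto: "\<And>a. bounded (range a) \<Longrightarrow> (\<lambda>n. \<Lambda> n a) \<longlonglongrightarrow> 0"
  shows False
proof -
  \<comment> \<open>The coordinates of projection minus identity; by \<open>id\<close> they vanish
    on finitely supported sequences.\<close>
  define \<mu> where "\<mu> n a = \<Lambda> n a - a n" for n a
  define L where "L n m = {X. inverse (real (Suc m)) < \<bar>\<mu> n (indicator (prefix_codes X))\<bar>}" for n m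
  have fin_L: "finite (L n m)" for n m
    unfolding L_def
  proof (rule finite_large_on_almost_disjoint[where C = "C + 1"])
    show "\<bar>\<mu> n a\<bar> \<le> C + 1" if "\<And>k. \<bar>a k\<bar> \<le> 1" for a
      using bound[of a n] that[of n] that by (fastforce simp: \<mu>_def)
  qed (auto simp: \<mu>_def add scale id algebra_simps finite_prefix_codes_Int)
  \<comment> \<open>If every \<open>\<mu> n\<close> vanished on the indicator of
    \<open>prefix_codes X\<close>, that indicator would equal its own projection and tend to 0,
    although it is 1 infinitely often. Hence countably many finite sets would cover all sets of
    naturals, against Cantor.\<close>
  have "X \<in> (\<Union>n. \<Union>m. L n m)" for X
  proof (rule ccontr)
    let ?a = "indicator (prefix_codes X) :: nat \<Rightarrow> real"
    assume "X \<notin> (\<Union>n. \<Union>m. L n m)"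
    then have le: "\<bar>\<mu> n ?a\<bar> \<le> inverse (real (Suc m))" for n m
      by (auto simp: L_def not_less)
    have "\<mu> n ?a = 0" for n
      using reals_Archimedean[of "\<bar>\<mu> n ?a\<bar>"] le by (meson not_less zero_less_abs_iff)
    then have "?a \<longlonglongrightarrow> 0"
      using tendsto[OF bounded_range_indicator, of "prefix_codes X"] by (simp add: \<mu>_def)
    then have "\<forall>\<^sub>F n in sequentially. ?a n < 1"
      by (rule order_tendstoD) simp
    then have "\<forall>\<^sub>F n in sequentially. n \<notin> prefix_codes X"
      by eventually_elim (auto simp: indicator_def)
    then show False
      using infinite_prefix_codes[of X]
      by (auto simp: eventually_sequentially infinite_nat_iff_unbounded_le)
  qed
  then have "(\<Union>n. \<Union>m. L n m) = UNIV"
    by blast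
  moreover have "countable (\<Union>n. \<Union>m. L n m)"
    by (simp add: countable_finite fin_L)
  ultimately have "countable (UNIV :: nat set set)"
    by (rule subst)
  then obtain f :: "nat set \<Rightarrow> nat" where "inj f"
    by (auto simp: countable_def)
  then have "range (inv f) = Pow UNIV"
    unfolding Pow_UNIV by (rule inj_imp_surj_inv)
  then show False
    using Cantors_theorem by blast
qed

section \<open>The space for the discrete distance as C(K) with an equivalent norm\<close>

text \<open>A continuous function on a compact space is bounded, and since distinct points have
  distance 1, twice a bound is a Lipschitz constant.\<close>

lemma Lip_b_discrete_iff:
  assumes "compact_space K"
  shows "f \<in> Lip_b K discrete_dist \<longleftrightarrow>
    f \<in> extensional (topspace K) \<and> continuous_map K euclideanreal f"
proof (intro iffI)
  assume f: "f \<in> extensional (topspace K) \<and> continuous_map K euclideanreal f"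
  then have "compactin euclideanreal (f ` topspace K)"
    using assms by (metis compact_space_def image_compactin)
  then have b: "bounded (f ` topspace K)"
    by (simp add: compact_imp_bounded)
  then obtain B where B: "\<And>x. x \<in> topspace K \<Longrightarrow> \<bar>f x\<bar> \<le> B"
    by (auto simp: bounded_iff)
  \<comment> \<open>The absolute value keeps the constant nonnegative even if \<open>K\<close> is
    empty, where \<open>B\<close> is arbitrary.\<close>
  have "ennreal \<bar>f x - f y\<bar> \<le> ennreal (2 * \<bar>B\<bar>) * discrete_dist x y"
    if "x \<in> topspace K" "y \<in> topspace K" for x y
    using B[OF that(1)] B[OF that(2)] by (auto simp: discrete_dist_def intro!: ennreal_leI)
  then show "f \<in> Lip_b K discrete_dist"
    using f b unfolding Lip_b_def by (auto intro!: exI[of _ "2 * \<bar>B\<bar>"])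
qed (auto simp: Lip_b_def)

text \<open>The factor 3 is 2 for the oscillation plus 1 for the supremum. Together with
  \<open>abs_le_Lip_b_norm\<close> this makes the norm equivalent to the supremum norm.\<close>

lemma Lip_b_norm_discrete_le:
  assumes "\<And>x. x \<in> topspace K \<Longrightarrow> \<bar>f x\<bar> \<le> c" "c \<ge> 0"
  shows "Lip_b_norm K discrete_dist f \<le> 3 * c"
proof -
  have "Lip_const K discrete_dist f \<le> ennreal (2 * c)"
    unfolding Lip_const_def
  proof (safe intro!: SUP_least)
    fix x y assume "x \<in> topspace K" "y \<in> topspace K" "x \<noteq> y"
    then show "ennreal \<bar>f x - f y\<bar> / discrete_dist x y \<le> ennreal (2 * c)"
      using assms(1)[of x] assms(1)[of y]
      by (auto simp: discrete_dist_def divide_ennreal_def intro!: ennreal_leI)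
  qed
  moreover have "(SUP x \<in> topspace K. ennreal \<bar>f x\<bar>) \<le> ennreal c"
    using assms by (intro SUP_least ennreal_leI) auto
  ultimately have "Lip_const K discrete_dist f + (SUP x \<in> topspace K. ennreal \<bar>f x\<bar>) \<le> ennreal (2 * c) + ennreal c"
    by (rule add_mono)
  also have "\<dots> = ennreal (3 * c)"
    using assms(2) by (simp flip: ennreal_plus)
  finally show ?thesis
    unfolding Lip_b_norm_def using assms(2) by (intro enn2real_leI) auto
qed

lemma abs_le_Lip_b_norm:
  assumes "f \<in> Lip_b K d" "x \<in> topspace K"
  shows "\<bar>f x\<bar> \<le> Lip_b_norm K d f"
proof -
  let ?N = "Lip_const K d f + (SUP x \<in> topspace K. ennreal \<bar>f x\<bar>)"
  have "ennreal \<bar>f x\<bar> \<le> (SUP x \<in> topspace K. ennreal \<bar>f x\<bar>)"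
    using assms(2) by (rule SUP_upper)
  also have "\<dots> \<le> ?N"
    by simp
  \<comment> \<open>Finiteness matters here, as \<open>enn2real\<close> sends infinity to 0.\<close>
  also have "\<dots> = ennreal (enn2real ?N)"
    using Lip_b_norm_finite[OF assms(1)] by simp
  finally show ?thesis
    by (simp add: Lip_b_norm_def)
qed

section \<open>Two-sided norm estimates for a linear homeomorphism\<close>

context
  fixes K :: "'a topology" and T :: "'v::real_normed_vector \<Rightarrow> 'a \<Rightarrow> real"
  assumes K: "compact_space K" and T: "linear_homeomorphism_Lip_b K discrete_dist T"
begin

interpretation Lip: Metric_space "Lip_b K discrete_dist" "Lip_b_dist K discrete_dist"
  by (rule Metric_space_Lip_b)

lemma Lip_b_iso_homeomorphic: "homeomorphic_map euclidean Lip.mtopology T"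
  using T by (simp add: linear_homeomorphism_Lip_b_def Lip_b_topology_def)

lemma Lip_b_iso_bij_betw: "bij_betw T UNIV (Lip_b K discrete_dist)"
  using homeomorphic_imp_injective_map[OF Lip_b_iso_homeomorphic] homeomorphic_imp_surjective_map[OF Lip_b_iso_homeomorphic]
  by (simp add: bij_betw_def)

lemma Lip_b_iso_in: "T u \<in> Lip_b K discrete_dist"
  using Lip_b_iso_bij_betw by (auto simp: bij_betw_def)

lemma Lip_b_iso_linear_eval:
  assumes "x \<in> topspace K"
  shows "linear (\<lambda>u. T u x)"
  using T assms by (intro linearI) (auto simp: linear_homeomorphism_Lip_b_def)

lemma Lip_b_iso_zero: "T 0 = (\<lambda>x\<in>topspace K. 0)"
  using T unfolding linear_homeomorphism_Lip_b_def by (metis (mono_tags, lifting) mult_zero_left restrict_ext scaleR_zero_left)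

text \<open>Lets balls around \<open>T 0\<close> be read as norm bounds. The sign comes from the
  order of subtraction in \<open>Lip_b_dist\<close>.\<close>

lemma Lip_b_iso_dist_zero: "Lip_b_dist K discrete_dist (T 0) (T u) = Lip_b_norm K discrete_dist (T (- u))"
proof -
  have "(\<lambda>x\<in>topspace K. T 0 x - T u x) = T (- u)"
  proof (rule extensionalityI[where A = "topspace K"])
    show "(\<lambda>x\<in>topspace K. T 0 x - T u x) x = T (- u) x" if "x \<in> topspace K" for x
      using that linear_neg[OF Lip_b_iso_linear_eval[OF that], of u] by (simp add: Lip_b_iso_zero)
  qed (use Lip_b_iso_in in \<open>auto simp: Lip_b_def\<close>)
  then show ?thesis
    by (simp add: Lip_b_dist_def)
qed

text \<open>Continuity at 0 bounds the values of \<open>T u\<close> by 1 on a small ball;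
  homogeneity extends the bound to all \<open>u\<close>.\<close>

lemma Lip_b_iso_bounded: "\<exists>C>0. \<forall>u. \<forall>x\<in>topspace K. \<bar>T u x\<bar> \<le> C * norm u"
proof -
  have "openin euclidean {u \<in> topspace euclidean. T u \<in> Lip.mball (T 0) 1}"
    using homeomorphic_imp_continuous_map[OF Lip_b_iso_homeomorphic] Lip.openin_mball
    by (rule openin_continuous_map_preimage)
  then have "open {u. T u \<in> Lip.mball (T 0) 1}"
    by simp
  moreover have "0 \<in> {u. T u \<in> Lip.mball (T 0) 1}"
    using Lip_b_iso_in by simp
  ultimately obtain e where e: "e > 0" "ball 0 e \<subseteq> {u. T u \<in> Lip.mball (T 0) 1}"
    by (meson openE)
  have small: "\<bar>T u x\<bar> \<le> 1" if "norm u < e" "x \<in> topspace K" for u x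
  proof -
    have "- u \<in> {u. T u \<in> Lip.mball (T 0) 1}"
      using e(2) that by (intro subsetD[OF e(2)]) simp
    then have "Lip_b_norm K discrete_dist (T (- (- u))) < 1"
      unfolding mem_Collect_eq Lip.in_mball Lip_b_iso_dist_zero by blast
    then show ?thesis
      using abs_le_Lip_b_norm[OF Lip_b_iso_in that(2), of u] by simp
  qed
  have "\<bar>T u x\<bar> \<le> 2 / e * norm u" if x: "x \<in> topspace K" for u x
  proof (cases "u = 0")
    case True
    then show ?thesis using x by (simp add: Lip_b_iso_zero)
  next
    case False
    \<comment> \<open>Scales \<open>u\<close> to norm \<open>e / 2\<close>, inside the ball just
      found.\<close>
    define c where "c = e / (2 * norm u)"
    have c: "c > 0" using False e by (simp add: c_def)
    have "norm (c *\<^sub>R u) < e"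
      using False e by (simp add: c_def)
    then have "\<bar>c * T u x\<bar> \<le> 1"
      using small[of "c *\<^sub>R u" x] x linear_scale[OF Lip_b_iso_linear_eval[OF x], of c u] by simp
    then have "\<bar>T u x\<bar> \<le> 1 / c"
      using c by (simp add: abs_mult field_simps)
    then show ?thesis
      using e by (simp add: c_def field_simps)
  qed
  then show ?thesis
    using e by (intro exI[of _ "2 / e"]) auto
qed

text \<open>Since \<open>T\<close> is open, the image of the unit ball contains a ball around
  \<open>T 0\<close>; injectivity carries membership back to the domain.\<close>

lemma Lip_b_iso_inverse_bounded: "\<exists>C>0. \<forall>u. (\<forall>x\<in>topspace K. \<bar>T u x\<bar> \<le> 1) \<longrightarrow> norm u \<le> C"
proof -
  have "openin Lip.mtopology (T ` ball 0 1)"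
    using homeomorphic_imp_open_map[OF Lip_b_iso_homeomorphic] by (auto simp: open_map_def)
  moreover have "T 0 \<in> T ` ball 0 1"
    by simp
  ultimately obtain r where r: "r > 0" "Lip.mball (T 0) r \<subseteq> T ` ball 0 1"
    unfolding Lip.openin_mtopology by blast
  have "norm u \<le> 4 / r" if u: "\<forall>x\<in>topspace K. \<bar>T u x\<bar> \<le> 1" for u
  proof -
    \<comment> \<open>Chosen so that \<open>3 * c < r\<close>, with the 3 of
      \<open>Lip_b_norm_discrete_le\<close>.\<close>
    define c where "c = r / 4"
    have c: "c > 0" using r by (simp add: c_def)
    have "\<bar>T (- (c *\<^sub>R u)) x\<bar> \<le> c" if x: "x \<in> topspace K" for x
      using u x c linear_neg[OF Lip_b_iso_linear_eval[OF x], of "c *\<^sub>R u"] linear_scale[OF Lip_b_iso_linear_eval[OF x], of c u]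
      by (simp add: abs_mult)
    then have "Lip_b_norm K discrete_dist (T (- (c *\<^sub>R u))) \<le> 3 * c"
      using c by (intro Lip_b_norm_discrete_le) auto
    also have "\<dots> < r"
      using r by (simp add: c_def)
    finally have "T (c *\<^sub>R u) \<in> T ` ball 0 1"
      using r(2) Lip_b_iso_in by (auto simp: Lip_b_iso_dist_zero)
    then have "c *\<^sub>R u \<in> ball 0 1"
      using Lip_b_iso_bij_betw inj_image_mem_iff[of T "c *\<^sub>R u" "ball 0 1"] by (simp add: bij_betw_def)
    then have "c * norm u < 1"
      using c by simp
    then show ?thesis
      using c r by (simp add: c_def field_simps)
  qed
  then show ?thesis
    using r by (intro exI[of _ "4 / r"]) auto
qed

end

section \<open>Disjoint bumps along a convergent sequence\<close>

text \<open>Compactness gives an accumulation point \<open>x\<close>. Choosing points whose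
  distances to \<open>x\<close> at least halve leaves room for tent functions of the distance to
  \<open>x\<close>, living on disjoint annuli.\<close>

lemma infinite_compact_metrizable_bumps:
  assumes "compact_space K" "metrizable_space K" "infinite (topspace K)"
  obtains x and y :: "nat \<Rightarrow> 'a" and f :: "nat \<Rightarrow> 'a \<Rightarrow> real" where
    "limitin K y x sequentially" "x \<in> topspace K" "\<And>n. y n \<in> topspace K"
    "\<And>n. continuous_map K euclideanreal (f n)"
    "\<And>n m. f n (y m) = (if m = n then 1 else 0)" "\<And>n. f n x = 0"
    "\<And>n z. 0 \<le> f n z" "\<And>n z. f n z \<le> 1"
    "\<And>n m z. n < m \<Longrightarrow> f n z = 0 \<or> f m z = 0"
proof -
  obtain M d where "Metric_space M d" and K: "K = Metric_space.mtopology M d"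
    using assms(2) by (auto simp: metrizable_space_def)
  interpret Metric_space M d by fact
  have "M \<inter> K derived_set_of M \<noteq> {}"
    using compactin_imp_Bolzano_Weierstrass[of K M M] assms by (simp add: compact_space_def K)
  then obtain x where x: "x \<in> M" "\<forall>r>0. \<exists>y\<in>M. y \<noteq> x \<and> y \<in> mball x r"
    unfolding K metric_derived_set_of by blast
  define P where "P y \<longleftrightarrow> y \<in> M \<and> y \<noteq> x" for y
  have "\<exists>y0. P y0"
    using x(2)[rule_format, of 1] by (auto simp: P_def)
  moreover have "\<exists>z. P z \<and> d x z \<le> d x y / 2" if "P y" for y
  proof -
    have "d x y / 2 > 0"
      using that x(1) by (auto simp: P_def intro!: mdist_pos_less)
    from x(2)[rule_format, OF this] show ?thesis
      by (auto simp: P_def less_imp_le)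
  qed
  ultimately obtain y :: "nat \<Rightarrow> 'a" where y: "\<And>n. P (y n)" "\<And>n. d x (y (Suc n)) \<le> d x (y n) / 2"
    using dependent_nat_choice[of "\<lambda>_. P" "\<lambda>_ y z. d x z \<le> d x y / 2"] by metis
  define r where "r n = d x (y n)" for n
  have r: "r n > 0" for n
    using y(1)[of n] x(1) by (auto simp: P_def r_def intro!: mdist_pos_less)
  have r_half: "r m \<le> r n / 2" if "n < m" for n m
    using that
  proof (induction m rule: less_Suc_induct)
    case (1 i)
    then show ?case using y(2) by (simp add: r_def)
  next
    case (2 i j k)
    then show ?case using r[of j] by linarith
  qed
  \<comment> \<open>A tent of height 1 at distance \<open>r n\<close>, nonzero only at distances
    strictly between 3/4 and 5/4 of \<open>r n\<close>.\<close>
  define f where "f n z = max 0 (1 - 4 * \<bar>d x z - r n\<bar> / r n)" for n z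
  have disj: "f n z = 0 \<or> f m z = 0" if "n < m" for n m z
  proof (rule ccontr)
    assume "\<not> ?thesis"
    then have "4 * \<bar>d x z - r n\<bar> / r n < 1" "4 * \<bar>d x z - r m\<bar> / r m < 1"
      unfolding f_def by linarith+
    then have "\<bar>d x z - r n\<bar> < r n / 4" "\<bar>d x z - r m\<bar> < r m / 4"
      using r by (simp_all add: field_simps)
    \<comment> \<open>The annuli cannot meet: halving gives \<open>5 * r m \<le> 5/2 * r n\<close>,
      which is below \<open>3 * r n\<close>.\<close>
    then have "3 * r n < 4 * d x z" "4 * d x z < 5 * r m"
      unfolding abs_less_iff by argo+
    with r_half[OF that] r[of n] show False
      by linarith
  qed
  have one: "f n (y n) = 1" for n
    by (simp add: f_def r_def)
  have "r n \<le> r 0 * (1/2) ^ n" for n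
    by (induction n) (use y(2) in \<open>auto simp: r_def intro: order.trans\<close>)
  moreover have "(\<lambda>n. r 0 * (1/2) ^ n) \<longlonglongrightarrow> r 0 * 0"
    by (intro tendsto_mult_left LIMSEQ_power_zero) simp
  ultimately have "r \<longlonglongrightarrow> 0"
    by (intro tendsto_sandwich[of "\<lambda>_. 0" r _ "\<lambda>n. r 0 * (1/2) ^ n"]) (auto simp: r less_imp_le)
  then have "limitin K y x sequentially"
    using x(1) y(1) unfolding K limitin_metric_dist_null
    by (simp add: P_def r_def[abs_def] commute)
  moreover have "continuous_map K euclideanreal (f n)" for n
  proof -
    have "continuous_map K euclideanreal (d x)"
      using continuous_on_mdist[of x "metric (M, d)"] x(1) by (simp add: K)
    then have "continuous_map K euclideanreal ((\<lambda>t. max 0 (1 - 4 * \<bar>t - r n\<bar> / r n)) \<circ> d x)"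
      using r[of n] by (intro continuous_map_compose) (auto intro!: continuous_intros)
    then show ?thesis
      by (simp add: f_def[abs_def] o_def)
  qed
  moreover have "f n (y m) = (if m = n then 1 else 0)" for n m
    using disj[of n m "y m"] disj[of m n "y m"] one by (cases n m rule: linorder_cases) auto
  moreover have "f n z \<le> 1" "0 \<le> f n z" "f n x = 0" for n z
    using r[of n] x(1) by (auto simp: f_def)
  ultimately show thesis
    by (intro that[of y x f] disj) (use x(1) y(1) in \<open>simp_all add: P_def K\<close>)
qed

text \<open>At each point at most one summand is nonzero, so the bound does not grow with the number
  of summands.\<close>

lemma sum_disjoint_bumps_le:
  fixes f :: "nat \<Rightarrow> 'a \<Rightarrow> real"
  assumes "\<And>n z. 0 \<le> f n z" "\<And>n z. f n z \<le> 1" "\<And>n m z. n < m \<Longrightarrow> f n z = 0 \<or> f m z = 0"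
    and "finite I" "\<And>n. \<bar>a n\<bar> \<le> 1"
  shows "\<bar>\<Sum>n\<in>I. a n * f n z\<bar> \<le> 1"
proof (cases "\<exists>n\<in>I. f n z \<noteq> 0")
  case True
  then obtain n where n: "n \<in> I" "f n z \<noteq> 0"
    by blast
  have other: "f m z = 0" if "m \<noteq> n" for m
    using assms(3)[of n m z] assms(3)[of m n z] n(2) that by (cases m n rule: linorder_cases) auto
  from n have "(\<Sum>n\<in>I. a n * f n z) = (\<Sum>n\<in>{n}. a n * f n z)"
    by (intro sum.mono_neutral_right) (use assms(4) other in auto)
  then show ?thesis
    using assms(1,2)[of n z] assms(5)[of n] by (simp add: abs_mult mult_le_one)
qed simp

section \<open>Weak* convergent series in a dual space\<close>

text \<open>Testing the bound with the signs of \<open>\<phi> n v\<close> shows that \<open>\<Sum>n. \<phi> n v\<close> converges absolutely.\<close>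

lemma weak_star_series:
  fixes \<phi> :: "nat \<Rightarrow> 'b::real_normed_vector \<Rightarrow>\<^sub>L real"
  assumes bound: "\<And>N a. (\<And>n. \<bar>a n\<bar> \<le> 1) \<Longrightarrow> norm (\<Sum>n<N. a n *\<^sub>R \<phi> n) \<le> C"
  obtains S :: "(nat \<Rightarrow> real) \<Rightarrow> 'b \<Rightarrow>\<^sub>L real" where
    "\<And>a b. bounded (range a) \<Longrightarrow> bounded (range b) \<Longrightarrow> S (\<lambda>k. a k + b k) = S a + S b"
    "\<And>c a. bounded (range a) \<Longrightarrow> S (\<lambda>k. c * a k) = c *\<^sub>R S a"
    "\<And>a. (\<And>k. \<bar>a k\<bar> \<le> 1) \<Longrightarrow> norm (S a) \<le> C"
    "\<And>a. finite {k. a k \<noteq> 0} \<Longrightarrow> S a = (\<Sum>k | a k \<noteq> 0. a k *\<^sub>R \<phi> k)"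
proof -
  have apply_sum: "blinfun_apply (\<Sum>n\<in>I. g n) v = (\<Sum>n\<in>I. blinfun_apply (g n) v)"
    for g :: "nat \<Rightarrow> 'b \<Rightarrow>\<^sub>L real" and I v
    by (rule blinfun.sum_left)
  have C: "C \<ge> 0"
    using bound[of "\<lambda>_. 0" 0] by simp
  have partial: "(\<Sum>n<N. \<bar>\<phi> n v\<bar>) \<le> C * norm v" for N v
  proof -
    have "(\<Sum>n<N. \<bar>\<phi> n v\<bar>) = (\<Sum>n<N. sgn (\<phi> n v) *\<^sub>R \<phi> n) v"
      by (simp add: apply_sum blinfun.scaleR_left abs_sgn mult.commute)
    also have "\<dots> \<le> norm (\<Sum>n<N. sgn (\<phi> n v) *\<^sub>R \<phi> n) * norm v"
      using norm_blinfun[of "\<Sum>n<N. sgn (\<phi> n v) *\<^sub>R \<phi> n" v] by simp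
    also have "\<dots> \<le> C * norm v"
      by (intro mult_right_mono bound) (auto simp: sgn_if)
    finally show ?thesis .
  qed
  have abs_summable: "summable (\<lambda>n. \<bar>\<phi> n v\<bar>)" for v
    by (rule summableI_nonneg_bounded[of _ "C * norm v"]) (simp_all add: partial)
  have suminf_le: "(\<Sum>n. \<bar>\<phi> n v\<bar>) \<le> C * norm v" for v
    by (rule suminf_le_const[OF abs_summable partial])
  \<comment> \<open>Comparison with \<open>B * \<bar>\<phi> n v\<bar>\<close> yields both
    convergence and a bound linear in \<open>norm v\<close>, hence a bounded functional.\<close>
  have dom: "summable (\<lambda>n. \<bar>a n * \<phi> n v\<bar>) \<and> (\<Sum>n. \<bar>a n * \<phi> n v\<bar>) \<le> B * (C * norm v)"
    if "\<And>n. \<bar>a n\<bar> \<le> B" for a B v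
  proof -
    have B: "B \<ge> 0"
      using that[of 0] by linarith
    have le: "\<bar>a n * \<phi> n v\<bar> \<le> B * \<bar>\<phi> n v\<bar>" for n
      using that[of n] by (simp add: abs_mult mult_right_mono)
    have s: "summable (\<lambda>n. B * \<bar>\<phi> n v\<bar>)"
      by (intro summable_mult abs_summable)
    then have "summable (\<lambda>n. \<bar>a n * \<phi> n v\<bar>)"
      by (rule summable_comparison_test'[of _ 0]) (use le in simp)
    moreover from Series.suminf_le[OF le this s] have "(\<Sum>n. \<bar>a n * \<phi> n v\<bar>) \<le> B * (\<Sum>n. \<bar>\<phi> n v\<bar>)"
      by (simp add: suminf_mult abs_summable)
    ultimately show ?thesis
      using suminf_le[of v] B by (meson mult_left_mono order.trans)
  qed
  have bnd: "\<exists>B. \<forall>n. \<bar>a n\<bar> \<le> B" if "bounded (range a)" for a :: "nat \<Rightarrow> real"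
    using that by (auto simp: bounded_iff)
  have summable: "summable (\<lambda>n. a n * \<phi> n v)" if "bounded (range a)" for a v
    using bnd[OF that] dom[of a _ v] by (auto intro: summable_rabs_cancel)
  \<comment> \<open>The sum is taken pointwise in \<open>v\<close>, which is the weak* sum.
    \<open>Blinfun\<close> can be evaluated only once the map is known to be bounded linear, shown
    below for bounded \<open>a\<close>.\<close>
  define S where "S a = Blinfun (\<lambda>v. \<Sum>n. a n * \<phi> n v)" for a
  have norm_le: "\<bar>\<Sum>n. a n * \<phi> n v\<bar> \<le> B * (C * norm v)" if "\<And>n. \<bar>a n\<bar> \<le> B" for a B v
    using summable_rabs[of "\<lambda>n. a n * \<phi> n v"] dom[of a B v, OF that] by (meson order.trans)
  have S: "S a v = (\<Sum>n. a n * \<phi> n v)" if a: "bounded (range a)" for a v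
  proof -
    obtain B where B: "\<And>n. \<bar>a n\<bar> \<le> B"
      using bnd[OF a] by blast
    have "bounded_linear (\<lambda>v. \<Sum>n. a n * \<phi> n v)"
    proof (rule bounded_linear_intro[where K = "B * C"])
      show "norm (\<Sum>n. a n * \<phi> n v) \<le> norm v * (B * C)" for v
        using norm_le[of a B v, OF B] by (simp add: ac_simps)
    qed (use summable[OF a] in \<open>auto simp: blinfun.bilinear_simps distrib_left suminf_add[symmetric] suminf_mult[symmetric] mult.left_commute\<close>)
    then show ?thesis
      by (simp add: S_def bounded_linear_Blinfun_apply)
  qed
  have bp: "bounded (range (\<lambda>k. a k + b k))" if "bounded (range a)" "bounded (range b)"
    for a b :: "nat \<Rightarrow> real"
    using that by (rule bounded_plus_comp)
  have bs: "bounded (range (\<lambda>k. c * a k))" if "bounded (range a)" for c and a :: "nat \<Rightarrow> real"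
    using bounded_scaleR_comp[OF that, of c] by simp
  show thesis
  proof
    show "S (\<lambda>k. a k + b k) = S a + S b" if "bounded (range a)" "bounded (range b)" for a b
      by (rule blinfun_eqI)
        (simp add: S bp that blinfun.add_left distrib_right suminf_add[symmetric] summable)
    show "S (\<lambda>k. c * a k) = c *\<^sub>R S a" if "bounded (range a)" for c a
      by (rule blinfun_eqI)
        (simp add: S bs that blinfun.scaleR_left suminf_mult[symmetric] summable mult.assoc)
    show "norm (S a) \<le> C" if a: "\<And>k. \<bar>a k\<bar> \<le> 1" for a
    proof (rule norm_blinfun_bound[OF C])
      have "bounded (range a)"
        using a by (auto simp: bounded_iff)
      then show "norm (S a v) \<le> C * norm v" for v
        using norm_le[of a 1 v, OF a] by (simp add: S)
    qed
    show "S a = (\<Sum>k | a k \<noteq> 0. a k *\<^sub>R \<phi> k)" if a: "finite {k. a k \<noteq> 0}" for a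
    proof (rule blinfun_eqI)
      fix v
      have "finite (range a)"
        using a by (intro finite_subset[of "range a" "insert 0 (a ` {k. a k \<noteq> 0})"]) auto
      then have "bounded (range a)"
        by (rule finite_imp_bounded)
      then have "S a v = (\<Sum>k | a k \<noteq> 0. a k * \<phi> k v)"
        using a by (auto simp: S intro!: suminf_finite)
      then show "S a v = (\<Sum>k | a k \<noteq> 0. a k *\<^sub>R \<phi> k) v"
        by (simp add: apply_sum blinfun.scaleR_left)
    qed
  qed
qed

section \<open>From an isomorphism with a dual to a projection onto the null sequences\<close>

theorem proposition2p16:
  fixes K :: "'a topology"
  assumes "compact_space K" and "metrizable_space K" and "infinite (topspace K)"
  shows "\<not> (\<exists>T :: ('b::banach \<Rightarrow>\<^sub>L real) \<Rightarrow> 'a \<Rightarrow> real.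
            linear_homeomorphism_Lip_b K discrete_dist T)"
proof
  assume "\<exists>T :: ('b \<Rightarrow>\<^sub>L real) \<Rightarrow> 'a \<Rightarrow> real. linear_homeomorphism_Lip_b K discrete_dist T"
  then obtain T :: "('b \<Rightarrow>\<^sub>L real) \<Rightarrow> 'a \<Rightarrow> real" where T: "linear_homeomorphism_Lip_b K discrete_dist T"
    by blast
  note T_lin = Lip_b_iso_linear_eval[OF assms(1) T]
  obtain x and y :: "nat \<Rightarrow> 'a" and f :: "nat \<Rightarrow> 'a \<Rightarrow> real" where
    lim: "limitin K y x sequentially" and x: "x \<in> topspace K" and y: "\<And>n. y n \<in> topspace K"
    and cont: "\<And>n. continuous_map K euclideanreal (f n)"
    and f_y: "\<And>n m. f n (y m) = (if m = n then 1 else 0)" and f_x: "\<And>n. f n x = 0"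
    and f: "\<And>n z. 0 \<le> f n z" "\<And>n z. f n z \<le> 1" "\<And>n m z. n < m \<Longrightarrow> f n z = 0 \<or> f m z = 0"
    by (rule infinite_compact_metrizable_bumps[OF assms]) blast
  have "restrict (f n) (topspace K) \<in> Lip_b K discrete_dist" for n
    unfolding Lip_b_discrete_iff[OF assms(1)] using continuous_map_eq[OF cont[of n]] by auto
  then have "\<exists>u. T u = restrict (f n) (topspace K)" for n
    using bij_betw_imp_surj_on[OF Lip_b_iso_bij_betw[OF assms(1) T]] by (metis imageE)
  then obtain \<phi> where \<phi>: "\<And>n. T (\<phi> n) = restrict (f n) (topspace K)"
    by metis
  have T_sum: "T (\<Sum>n\<in>I. a n *\<^sub>R \<phi> n) z = (\<Sum>n\<in>I. a n * f n z)" if "z \<in> topspace K" for I a z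
    using that by (simp add: linear_sum[OF T_lin[OF that]] linear_scale[OF T_lin[OF that]] \<phi>)
  obtain C where C: "\<And>u. (\<forall>z\<in>topspace K. \<bar>T u z\<bar> \<le> 1) \<Longrightarrow> norm u \<le> C"
    using Lip_b_iso_inverse_bounded[OF assms(1) T] by blast
  obtain D where D: "D > 0" "\<And>u z. z \<in> topspace K \<Longrightarrow> \<bar>T u z\<bar> \<le> D * norm u"
    using Lip_b_iso_bounded[OF assms(1) T] by blast
  show False
  proof (rule weak_star_series[of \<phi> C])
    \<comment> \<open>The image under \<open>T\<close> is a signed sum of disjoint bumps, bounded by
      1 on \<open>K\<close>; the inverse estimate then bounds the preimage uniformly in
      \<open>N\<close>.\<close>
    show "norm (\<Sum>n<N. a n *\<^sub>R \<phi> n) \<le> C" if "\<And>n. \<bar>a n\<bar> \<le> 1" for N a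
      using sum_disjoint_bumps_le[of f "{..<N}" a, OF f _ that] by (intro C) (simp add: T_sum)
  next
    fix S :: "(nat \<Rightarrow> real) \<Rightarrow> 'b \<Rightarrow>\<^sub>L real"
    assume S: "\<And>a b. bounded (range a) \<Longrightarrow> bounded (range b) \<Longrightarrow> S (\<lambda>k. a k + b k) = S a + S b"
      "\<And>c a. bounded (range a) \<Longrightarrow> S (\<lambda>k. c * a k) = c *\<^sub>R S a"
      "\<And>a. (\<And>k. \<bar>a k\<bar> \<le> 1) \<Longrightarrow> norm (S a) \<le> C"
      "\<And>a. finite {k. a k \<noteq> 0} \<Longrightarrow> S a = (\<Sum>k | a k \<noteq> 0. a k *\<^sub>R \<phi> k)"
    \<comment> \<open>Subtracting the value at the limit point \<open>x\<close> forces convergence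
      to 0 by continuity of \<open>T (S a)\<close>. It leaves finitely supported sequences unchanged
      because every bump vanishes at \<open>x\<close>.\<close>
    define \<Lambda> where "\<Lambda> n a = T (S a) (y n) - T (S a) x" for n a
    \<comment> \<open>The constant counts two point evaluations, each at most
      \<open>D * norm (S a) \<le> D * C\<close>.\<close>
    show False
    proof (rule no_projection_onto_c0[of \<Lambda> "2 * (D * C)"])
      show "\<Lambda> n (\<lambda>k. a k + b k) = \<Lambda> n a + \<Lambda> n b" if "bounded (range a)" "bounded (range b)" for n a b
        using that x y by (simp add: \<Lambda>_def S linear_add[OF T_lin])
      show "\<Lambda> n (\<lambda>k. c * a k) = c * \<Lambda> n a" if "bounded (range a)" for n c a
        using that x y by (simp add: \<Lambda>_def S linear_scale[OF T_lin] right_diff_distrib)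
      show "\<bar>\<Lambda> n a\<bar> \<le> 2 * (D * C)" if "\<And>k. \<bar>a k\<bar> \<le> 1" for n a
      proof -
        have "D * norm (S a) \<le> D * C"
          using D(1) S(3)[of a, OF that] by simp
        then show ?thesis
          using D(2)[OF x, of "S a"] D(2)[OF y[of n], of "S a"] unfolding \<Lambda>_def by linarith
      qed
      show "\<Lambda> n a = a n" if "finite {k. a k \<noteq> 0}" for n a
        using that x y by (simp add: \<Lambda>_def S(4) T_sum f_x f_y if_distrib sum.delta cong: if_cong)
      show "(\<lambda>n. \<Lambda> n a) \<longlonglongrightarrow> 0" for a
      proof -
        have "continuous_map K euclideanreal (T (S a))"
          using Lip_b_iso_in[OF assms(1) T, of "S a"] by (simp add: Lip_b_discrete_iff[OF assms(1)])
        then have "limitin euclideanreal (T (S a) \<circ> y) (T (S a) x) sequentially"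
          using lim by (rule continuous_map_limit)
        then have "(\<lambda>n. T (S a) (y n)) \<longlonglongrightarrow> T (S a) x"
          by (simp add: o_def)
        then show ?thesis
          unfolding \<Lambda>_def by (simp add: LIM_zero)
      qed
    qed
  qed
qed

end
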